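(* Let $\mathcal H$ be a complex Hilbert space of finite dimension $n$ with $3\le n<+\infty$, and let $\phi:\mathcal P_1(\mathcal H)\to\mathcal P_1(\mathcal H)$ be a surjective map. Then the following are equivalent. (1) $\phi$ preserves the joint spectrum of any $n$ rank one projections, i.e. $\sigma([\phi(P_1),\dots,\phi(P_n)])=\sigma([P_1,\dots,P_n])$ for all $P_1,\dots,P_n\in\mathcal P_1(\mathcal H)$. (2) There exist an orthonormal basis $\alpha_1,\dots,\alpha_n$ of $\mathcal H$, a basis $\beta_1,\dots,\beta_n$ of $\mathcal H$ and a ring automorphism $f$ of $\mathbb C$ such that $$\phi(P)(\mathcal H)=\{\hat f(P\xi):\xi\in\mathcal H\}\quad\text{for all }P\in\mathcal P_1(\mathcal H),$$ where $\hat f:\mathcal H\to\mathcal H$ is given by $\hat f(z_1\alpha_1+\dots+z_n\alpha_n)=f(z_1)\beta_1+\dots+f(z_n)\beta_n$ for $z_1,\dots,z_n\in\mathbb C$.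
   Context: $\mathcal P_1(\mathcal H)$ denotes the set of all rank one (orthogonal) projections on $\mathcal H$; $P(\mathcal H)$ denotes the range of $P$. For operators $A_1,\dots,A_l$ on $\mathcal H$, the joint spectrum is $\sigma([A_1,\dots,A_l])=\{(c_1,\dots,c_l)\in\mathbb C^l: c_1A_1+\dots+c_lA_l\text{ is not invertible in }\mathcal B(\mathcal H)\}$. A ring automorphism of $\mathbb C$ is a bijection $f:\mathbb C\to\mathbb C$ with $f(z+w)=f(z)+f(w)$ and $f(zw)=f(z)f(w)$ (no continuity is assumed). *)

theory Defs
  imports "HOL-Analysis.Analysis"
begin

text \<open>
  The inner product is conjugate linear in its first and linear in its second argument.
  The norm, and hence the topology, is the one of \<^class>\<open>real_normed_vector\<close>, tied to the
  inner product and to the complex scalar multiplication by the axioms below.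
\<close>

class complex_inner = real_normed_vector +
  fixes scaleC :: "complex \<Rightarrow> 'a \<Rightarrow> 'a"  (infixr \<open>*\<^sub>C\<close> 75)
    and cinner :: "'a \<Rightarrow> 'a \<Rightarrow> complex"
  assumes scaleC_add_right: "a *\<^sub>C (x + y) = a *\<^sub>C x + a *\<^sub>C y"
    and scaleC_add_left: "(a + b) *\<^sub>C x = a *\<^sub>C x + b *\<^sub>C x"
    and scaleC_scaleC: "a *\<^sub>C (b *\<^sub>C x) = (a * b) *\<^sub>C x"
    and scaleC_one: "1 *\<^sub>C x = x"
    and scaleR_scaleC: "r *\<^sub>R x = complex_of_real r *\<^sub>C x"
    and cinner_commute: "cinner x y = cnj (cinner y x)"
    and cinner_add_right: "cinner x (y + z) = cinner x y + cinner x z"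
    and cinner_scaleC_right: "cinner x (a *\<^sub>C y) = a * cinner x y"
    and cinner_ge_zero: "0 \<le> Re (cinner x x)"
    and cinner_eq_zero_iff: "cinner x x = 0 \<longleftrightarrow> x = 0"
    and norm_eq_sqrt_cinner: "norm x = sqrt (Re (cinner x x))"

class chilbert_space = complex_inner + complete_space

global_interpretation cvec: vector_space "scaleC :: complex \<Rightarrow> 'a \<Rightarrow> 'a::complex_inner"
  by unfold_locales
    (simp_all add: scaleC_add_right scaleC_add_left scaleC_scaleC scaleC_one)

text \<open>
  In infinite dimension \<open>cvec.dim\<close> takes the value 0, so that \<open>cvec.dim V = n\<close> with \<open>n > 0\<close>
  includes finite dimensionality.
\<close>

text \<open>The algebra of bounded complex linear operators.\<close>

definition bounded_ops :: "('a::complex_inner \<Rightarrow> 'a) set" where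
  "bounded_ops = {A. bounded_linear A \<and> (\<forall>c x. A (c *\<^sub>C x) = c *\<^sub>C A x)}"

definition invertible_op :: "('a::complex_inner \<Rightarrow> 'a) \<Rightarrow> bool" where
  "invertible_op A \<longleftrightarrow> A \<in> bounded_ops \<and> (\<exists>B\<in>bounded_ops. A \<circ> B = id \<and> B \<circ> A = id)"

definition rank_one_projections :: "('a::complex_inner \<Rightarrow> 'a) set" where
  "rank_one_projections =
     {P \<in> bounded_ops. P \<circ> P = P \<and> (\<forall>x y. cinner (P x) y = cinner x (P y)) \<and>
        cvec.dim (range P) = 1}"

text \<open>A tuple of length \<open>l\<close>, of operators or of scalars, is a list of length \<open>l\<close>.\<close>

definition joint_spectrum :: "('a::complex_inner \<Rightarrow> 'a) list \<Rightarrow> complex list set" where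
  "joint_spectrum As =
     {cs. length cs = length As \<and>
        \<not> invertible_op (\<lambda>x. \<Sum>i<length As. (cs ! i) *\<^sub>C (As ! i) x)}"

text \<open>Bases are families indexed by \<open>{..<n}\<close>; values at other indices are irrelevant.\<close>

definition is_basis :: "nat \<Rightarrow> (nat \<Rightarrow> 'a::complex_inner) \<Rightarrow> bool" where
  "is_basis n b \<longleftrightarrow> inj_on b {..<n} \<and> cvec.independent (b ` {..<n}) \<and>
     cvec.span (b ` {..<n}) = UNIV"

definition is_orthonormal_basis :: "nat \<Rightarrow> (nat \<Rightarrow> 'a::complex_inner) \<Rightarrow> bool" where
  "is_orthonormal_basis n b \<longleftrightarrow> is_basis n b \<and>
     (\<forall>i<n. \<forall>j<n. cinner (b i) (b j) = (if i = j then 1 else 0))"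

definition ring_automorphism :: "(complex \<Rightarrow> complex) \<Rightarrow> bool" where
  "ring_automorphism f \<longleftrightarrow> bij f \<and> (\<forall>z w. f (z + w) = f z + f w) \<and>
     (\<forall>z w. f (z * w) = f z * f w)"

end

theory Submission
  imports Defs
begin

text \<open>
  A rank one projection is determined by its range, so \<open>\<phi>\<close> is a map on the lines of the space.
  Write \<open>P\<^sub>i\<close> for the projection onto the line of \<open>x\<^sub>i\<close>. The range of \<open>c\<^sub>1 P\<^sub>1 + \<dots> + c\<^sub>n P\<^sub>n\<close> lies in
  the span of those \<open>x\<^sub>i\<close> with \<open>c\<^sub>i \<noteq> 0\<close>, so in dimension \<open>n\<close> invertibility forces all \<open>c\<^sub>i\<close> to be
  nonzero and the \<open>x\<^sub>i\<close> to be a basis. Conversely, in that case a vector in the kernel is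
  orthogonal to every \<open>x\<^sub>i\<close>, hence zero (\<open>invertible_line_proj_combination_iff\<close>). The joint spectrum of
  \<open>n\<close> rank one projections therefore carries exactly one bit of information, namely whether their
  lines are independent, and to preserve these spectra is to preserve independence of \<open>n\<close> lines in
  both directions (\<open>joint_spectrum_line_proj_eq_iff\<close>).

  A semilinear bijection has this property, because it sends linear relations to linear
  relations with transformed coefficients (\<open>lin_indep_semilinear_image\<close>).

  For the other implication, completing shorter families to bases shows that independence of
  families of any length is preserved in both directions (\<open>lin_indep_iff\<close>). In particular distinct
  lines have distinct images and coplanar lines have coplanar images, and the fundamental theorem
  of projective geometry (\<open>fundamental_theorem\<close>) makes \<open>\<phi>\<close> semilinear; here \<open>n \<ge> 3\<close> enters. It is
  proved by the classical normalisation. Fix a vector \<open>e\<close>, a complementary hyperplane \<open>W\<close> and a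
  representative \<open>b\<close> of the image of the line of \<open>e\<close>. For \<open>x \<in> W\<close> the image of the line of \<open>e + x\<close> lies in
  the plane of \<open>b\<close> and the image line of \<open>x\<close>, which singles out one representative \<open>lift x\<close> of that
  image line by the condition that \<open>b + lift x\<close> represent the image of \<open>e + x\<close>. Computing the
  image of \<open>e + x + y\<close> as the intersection of two planes shows that \<open>lift\<close> is additive (\<open>lift_add\<close>).
  Additivity then forces the factor in \<open>lift (c x) = f(c) lift x\<close> to be independent of \<open>x\<close> and \<open>f\<close> to be
  a field homomorphism, and \<open>f\<close> is onto because \<open>\<phi>\<close> is (\<open>surj_scalar_map\<close>).
\<close>

section \<open>Independence of finite lists\<close>

text \<open>
  Lines are listed with repetitions and in a fixed order, so independence is a property of lists:
  a list with a repeated entry is dependent even if the set of its entries is independent.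
\<close>

locale list_independence = vector_space scale
  for scale :: "'k::field \<Rightarrow> 'v::ab_group_add \<Rightarrow> 'v" (infixr "\<cdot>" 75)
begin

definition lin_indep :: "'v list \<Rightarrow> bool" where
  "lin_indep xs \<longleftrightarrow> distinct xs \<and> independent (set xs)"

lemma lin_indep_Nil [simp]: "lin_indep []"
  by (simp add: lin_indep_def independent_empty)

lemma lin_indep_Cons: "lin_indep (x # xs) \<longleftrightarrow> lin_indep xs \<and> x \<notin> span (set xs)"
  by (auto simp: lin_indep_def independent_insert span_base)

lemma lin_indep_swap: "lin_indep [x, y] \<longleftrightarrow> lin_indep [y, x]"
  using insert_commute[of x y "{}"] by (auto simp: lin_indep_def)

lemma lin_indep_appendD: "lin_indep (xs @ ys) \<Longrightarrow> lin_indep xs"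
  using independent_mono[of "set (xs @ ys)" "set xs"] by (simp add: lin_indep_def)

lemma lin_indep_nonzero: "lin_indep xs \<Longrightarrow> x \<in> set xs \<Longrightarrow> x \<noteq> 0"
  using dependent_zero by (auto simp: lin_indep_def)

lemma in_span_set_list:
  "v \<in> span (set xs) \<longleftrightarrow> (\<exists>c. v = (\<Sum>i<length xs. c i \<cdot> (xs ! i)))"
proof (induction xs arbitrary: v)
  case Nil
  show ?case by simp
next
  case (Cons x xs)
  have "v \<in> span (set (x # xs)) \<longleftrightarrow> (\<exists>k c. v - k \<cdot> x = (\<Sum>i<length xs. c i \<cdot> (xs ! i)))"
    by (simp add: span_breakdown_eq Cons.IH)
  also have "\<dots> \<longleftrightarrow> (\<exists>c. v = (\<Sum>i<length (x # xs). c i \<cdot> ((x # xs) ! i)))"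
  proof (safe)
    fix k c
    assume "v - k \<cdot> x = (\<Sum>i<length xs. c i \<cdot> (xs ! i))"
    then have "v = (\<Sum>i<length (x # xs). (case i of 0 \<Rightarrow> k | Suc j \<Rightarrow> c j) \<cdot> ((x # xs) ! i))"
      by (simp add: sum.lessThan_Suc_shift algebra_simps del: sum.lessThan_Suc)
    then show "\<exists>c. v = (\<Sum>i<length (x # xs). c i \<cdot> ((x # xs) ! i))"
      by blast
  next
    fix c
    have "(\<Sum>i<length (x # xs). c i \<cdot> ((x # xs) ! i)) - c 0 \<cdot> x
        = (\<Sum>i<length xs. c (Suc i) \<cdot> (xs ! i))"
      by (simp add: sum.lessThan_Suc_shift del: sum.lessThan_Suc)
    then show "\<exists>k d. (\<Sum>i<length (x # xs). c i \<cdot> ((x # xs) ! i)) - k \<cdot> x = (\<Sum>i<length xs. d i \<cdot> (xs ! i))"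
      by (intro exI)
  qed
  finally show ?case .
qed

lemma lin_indep_ConsD:
  assumes ind: "lin_indep (x # xs)" and u: "u \<in> span (set xs)" "u' \<in> span (set xs)"
    and eq: "a \<cdot> x + u = a' \<cdot> x + u'"
  shows "a = a' \<and> u = u'"
proof -
  have "(a - a') \<cdot> x = u' - u"
    using eq by (simp add: scale_left_diff_distrib algebra_simps)
  then have "(a - a') \<cdot> x \<in> span (set xs)"
    using u by (simp add: span_diff)
  then have "inverse (a - a') \<cdot> (a - a') \<cdot> x \<in> span (set xs)"
    by (rule span_scale)
  then have "a = a'"
    using ind by (cases "a = a'") (simp_all add: lin_indep_Cons)
  then show ?thesis
    using eq by simp
qed

lemma lin_indep_iff_coeffs:
  "lin_indep xs \<longleftrightarrow> (\<forall>c. (\<Sum>i<length xs. c i \<cdot> (xs ! i)) = 0 \<longrightarrow> (\<forall>i<length xs. c i = 0))"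
proof (induction xs)
  case Nil
  show ?case by simp
next
  case (Cons x xs)
  note shift = sum.lessThan_Suc_shift
  show ?case
  proof (safe)
    fix c i
    assume ind: "lin_indep (x # xs)" and i: "i < length (x # xs)"
      and "(\<Sum>i<length (x # xs). c i \<cdot> ((x # xs) ! i)) = 0"
    then have s: "c 0 \<cdot> x + (\<Sum>i<length xs. c (Suc i) \<cdot> (xs ! i)) = 0"
      by (simp add: shift del: sum.lessThan_Suc)
    have "(\<Sum>i<length xs. c (Suc i) \<cdot> (xs ! i)) \<in> span (set xs)"
      unfolding in_span_set_list by (intro exI[of _ "\<lambda>i. c (Suc i)"] refl)
    then have "c 0 = 0"
      using lin_indep_ConsD[OF ind, of _ 0 "c 0" 0] s by (simp add: span_zero)
    moreover have "\<forall>i<length xs. c (Suc i) = 0"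
      using spec[OF Cons.IH[THEN iffD1], of "\<lambda>i. c (Suc i)"] ind s \<open>c 0 = 0\<close>
      by (simp add: lin_indep_Cons)
    ultimately show "c i = 0"
      using i by (cases i) auto
  next
    assume *: "\<forall>c. (\<Sum>i<length (x # xs). c i \<cdot> ((x # xs) ! i)) = 0 \<longrightarrow> (\<forall>i<length (x # xs). c i = 0)"
    have "lin_indep xs"
      unfolding Cons.IH
    proof (intro allI impI)
      fix c i
      assume "(\<Sum>i<length xs. c i \<cdot> (xs ! i)) = 0" "i < length xs"
      then show "c i = 0"
        using spec[OF *, of "case_nat 0 c"]
        by (auto simp: shift simp del: sum.lessThan_Suc)
    qed
    moreover have "x \<notin> span (set xs)"
    proof
      assume "x \<in> span (set xs)"
      then obtain c where c: "x = (\<Sum>i<length xs. c i \<cdot> (xs ! i))"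
        unfolding in_span_set_list by blast
      have "(\<Sum>i<length (x # xs). (case i of 0 \<Rightarrow> -1 | Suc j \<Rightarrow> c j) \<cdot> ((x # xs) ! i)) = 0"
        using c by (simp add: shift del: sum.lessThan_Suc)
      then show False
        using * by force
    qed
    ultimately show "lin_indep (x # xs)"
      by (simp add: lin_indep_Cons)
  qed
qed

lemma lin_indep_coeffsD:
  assumes "lin_indep xs" "(\<Sum>i<length xs. c i \<cdot> (xs ! i)) = 0" "i < length xs"
  shows "c i = 0"
  using assms lin_indep_iff_coeffs by blast

lemma lin_indep_pairD:
  assumes ind: "lin_indep [x, y]" and eq: "a \<cdot> x + b \<cdot> y = a' \<cdot> x + b' \<cdot> y"
  shows "a = a' \<and> b = b'"
proof -
  have 1: "a = a' \<and> b \<cdot> y = b' \<cdot> y"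
    by (rule lin_indep_ConsD[OF ind _ _ eq]) (simp_all add: span_scale span_base)
  have "y \<noteq> 0"
    using ind lin_indep_nonzero by simp
  then show ?thesis
    using 1 scale_right_imp_eq by blast
qed

lemma lin_indep_tripleD:
  assumes ind: "lin_indep [x, y, z]"
    and eq: "a \<cdot> x + b \<cdot> y + c \<cdot> z = a' \<cdot> x + b' \<cdot> y + c' \<cdot> z"
  shows "a = a' \<and> b = b' \<and> c = c'"
proof -
  have 1: "a = a' \<and> b \<cdot> y + c \<cdot> z = b' \<cdot> y + c' \<cdot> z"
    by (rule lin_indep_ConsD[OF ind _ _ eq[unfolded add.assoc]])
      (simp_all add: span_add span_scale span_base)
  have "lin_indep [y, z]"
    using ind unfolding lin_indep_Cons[of x] by blast
  then show ?thesis
    using 1 lin_indep_pairD by blast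
qed

text \<open>
  As \<open>f\<close> is onto, every linear combination of the images is the image of a linear combination,
  with zero coefficients on one side exactly when they are zero on the other.
\<close>

lemma lin_indep_semilinear_image:
  assumes add: "\<And>x y. g (x + y) = g x + g y" and scale: "\<And>c x. g (c \<cdot> x) = f c \<cdot> g x"
    and zero: "\<And>x. g x = 0 \<longleftrightarrow> x = 0" and f: "surj f" "\<And>c. f c = 0 \<longleftrightarrow> c = 0"
  shows "lin_indep (map g xs) \<longleftrightarrow> lin_indep xs"
proof -
  have sum: "(\<Sum>i<length xs. f (c i) \<cdot> (map g xs ! i)) = g (\<Sum>i<length xs. c i \<cdot> (xs ! i))" for c
  proof -
    have "g (\<Sum>i<k. c i \<cdot> (xs ! i)) = (\<Sum>i<k. f (c i) \<cdot> g (xs ! i))" for k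
      by (induction k) (simp_all add: add scale zero)
    then show ?thesis
      by simp
  qed
  have "lin_indep (map g xs) \<longleftrightarrow>
      (\<forall>c. (\<Sum>i<length xs. f (c i) \<cdot> (map g xs ! i)) = 0 \<longrightarrow> (\<forall>i<length xs. f (c i) = 0))"
    unfolding lin_indep_iff_coeffs
  proof (safe)
    (* Any coefficients d are of the form f o c, by surjectivity of f. *)
    fix d i
    assume *: "\<forall>c. (\<Sum>i<length xs. f (c i) \<cdot> (map g xs ! i)) = 0 \<longrightarrow> (\<forall>i<length xs. f (c i) = 0)"
      and d: "(\<Sum>i<length (map g xs). d i \<cdot> (map g xs ! i)) = 0" and i: "i < length (map g xs)"
    have "f (inv f (d j)) = d j" for j
      by (rule surj_f_inv_f[OF f(1)])
    then show "d i = 0"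
      using spec[OF *, of "\<lambda>i. inv f (d i)"] d i by simp
  qed (erule_tac x = "\<lambda>i. f (c i)" in allE, simp)
  then show ?thesis
    by (simp only: sum zero f(2) lin_indep_iff_coeffs[of xs])
qed

lemma in_span_pair: "z \<in> span {x, y} \<longleftrightarrow> (\<exists>a b. z = a \<cdot> x + b \<cdot> y)"
proof
  assume "z \<in> span {x, y}"
  then obtain a b where "z - a \<cdot> x = b \<cdot> y"
    by (auto simp: span_breakdown_eq)
  then show "\<exists>a b. z = a \<cdot> x + b \<cdot> y"
    by (intro exI[of _ a] exI[of _ b]) (simp add: algebra_simps)
next
  assume "\<exists>a b. z = a \<cdot> x + b \<cdot> y"
  then obtain a b where "z = a \<cdot> x + b \<cdot> y"
    by blast
  moreover have "x \<in> span {x, y}" "y \<in> span {x, y}"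
    by (simp_all add: span_base)
  ultimately show "z \<in> span {x, y}"
    by (simp add: span_add span_scale)
qed

lemma lin_indep_pair_iff: "lin_indep [x, y] \<longleftrightarrow> y \<noteq> 0 \<and> (\<forall>c. x \<noteq> c \<cdot> y)"
  by (auto simp: lin_indep_Cons span_singleton)

end

locale finite_dimensional_list_independence =
  list_independence scale + finite_dimensional_vector_space scale Basis
  for scale :: "'k::field \<Rightarrow> 'v::ab_group_add \<Rightarrow> 'v" (infixr "\<cdot>" 75) and Basis
begin

lemma lin_indep_extend:
  assumes "lin_indep xs"
  obtains us where "lin_indep (xs @ us)" "length (xs @ us) = dimension"
proof -
  let ?B = "extend_basis (set xs)"
  have ind: "independent (set xs)"
    using assms by (simp add: lin_indep_def)
  have B: "set xs \<subseteq> ?B" "independent ?B" "span ?B = UNIV"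
    using ind by (simp_all add: extend_basis_superset independent_extend_basis)
  then have "finite ?B"
    using finiteI_independent by blast
  then obtain us where us: "set us = ?B - set xs" "distinct us"
    using finite_distinct_list[of "?B - set xs"] by auto
  have un: "set (xs @ us) = ?B"
    using us B by auto
  have "distinct (xs @ us)"
    using us assms by (auto simp: lin_indep_def)
  moreover have "card ?B = dimension"
    using B by (metis basis_card_eq_dim dim_UNIV dimension_def subset_UNIV top.extremum)
  ultimately show thesis
    using that[of us] B un by (metis lin_indep_def distinct_card)
qed

lemma span_eq_UNIV_if_lin_indep:
  assumes "lin_indep xs" "length xs = dimension"
  shows "span (set xs) = UNIV"
  using assms card_ge_dim_independent[of "set xs" UNIV]
  by (auto simp: lin_indep_def distinct_card dimension_def)

lemma lin_indep_if_span_eq_UNIV: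
  assumes span: "span (set xs) = UNIV" and le: "length xs \<le> dimension"
  shows "lin_indep xs" "length xs = dimension"
proof -
  have "dimension \<le> card (set xs)"
    using dim_le_card[of UNIV "set xs"] span by (simp add: dimension_def)
  then have card: "card (set xs) = length xs" "length xs = dimension"
    using card_length[of xs] le by auto
  then have "independent (set xs)"
    using span by (intro card_le_dim_spanning[of _ UNIV]) (auto simp: dimension_def)
  then show "lin_indep xs" "length xs = dimension"
    using card by (simp_all add: lin_indep_def card_distinct)
qed

end

section \<open>Correspondences of lines that preserve independence\<close>

text \<open>
  A map between lines is represented by the relation \<open>R\<close> that holds of two nonzero vectors if the
  line of the second is the image of the line of the first. In this form no representatives have
  to be chosen, and the hypotheses are invariant under passing to the converse relation
  (\<open>converse\<close>), so that each fact about images comes with one about preimages.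
\<close>

locale line_correspondence = finite_dimensional_list_independence scale Basis
  for scale :: "'k::field \<Rightarrow> 'v::ab_group_add \<Rightarrow> 'v" (infixr "\<cdot>" 75) and Basis +
  fixes R :: "'v \<Rightarrow> 'v \<Rightarrow> bool"
  assumes nonzero: "R x y \<Longrightarrow> x \<noteq> 0 \<and> y \<noteq> 0"
    and total: "x \<noteq> 0 \<Longrightarrow> \<exists>y. R x y"
    and onto: "y \<noteq> 0 \<Longrightarrow> \<exists>x. R x y"
    and scale_right: "R x y \<Longrightarrow> c \<noteq> 0 \<Longrightarrow> R x (c \<cdot> y)"
    and scale_left: "R x y \<Longrightarrow> c \<noteq> 0 \<Longrightarrow> R (c \<cdot> x) y"
    and lin_indep_full: "list_all2 R xs ys \<Longrightarrow> length xs = dimension \<Longrightarrow> lin_indep xs \<longleftrightarrow> lin_indep ys"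
begin

lemma converse: "line_correspondence scale Basis (\<lambda>y x. R x y)"
proof
  fix xs ys
  assume "list_all2 (\<lambda>y x. R x y) xs ys" "length xs = dimension"
  then have "list_all2 R ys xs" "length ys = dimension"
    by (auto simp: list_all2_conv_all_nth)
  then show "lin_indep xs \<longleftrightarrow> lin_indep ys"
    using lin_indep_full by blast
qed (use nonzero total onto scale_right scale_left in blast)+

text \<open>
  The list is completed to a basis; the image of a basis is a basis, and a part of it is independent.
\<close>

lemma lin_indep_image:
  assumes R: "list_all2 R xs ys" and ind: "lin_indep xs"
  shows "lin_indep ys"
proof -
  obtain us where us: "lin_indep (xs @ us)" "length (xs @ us) = dimension"
    using lin_indep_extend[OF ind] .
  define g where "g x = (SOME y. R x y)" for x
  have "R u (g u)" if "u \<in> set us" for u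
    unfolding g_def using lin_indep_nonzero[OF us(1)] that by (auto intro: someI_ex total)
  then have "list_all2 R (xs @ us) (ys @ map g us)"
    using R by (intro list_all2_appendI) (auto simp: list_all2_conv_all_nth)
  then have "lin_indep (ys @ map g us)"
    using lin_indep_full us by blast
  then show ?thesis
    by (rule lin_indep_appendD)
qed

lemma lin_indep_iff: "list_all2 R xs ys \<Longrightarrow> lin_indep xs \<longleftrightarrow> lin_indep ys"
  using lin_indep_image line_correspondence.lin_indep_image[OF converse, of ys xs]
  by (auto simp: list_all2_conv_all_nth)

text \<open>
  The pair \<open>x, x\<close> is dependent, so the pair of its two images is dependent as well.
\<close>

lemma image_unique:
  assumes "R x y" "R x y'"
  obtains c where "c \<noteq> 0" "y' = c \<cdot> y"
proof -
  have "\<not> lin_indep [x, x]"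
    by (simp add: lin_indep_def)
  then have "\<not> lin_indep [y', y]"
    using lin_indep_iff[of "[x, x]" "[y', y]"] assms by simp
  then show thesis
    using nonzero[OF assms(1)] nonzero[OF assms(2)] that unfolding lin_indep_pair_iff
    by (metis scale_zero_left)
qed

text \<open>
  Three coplanar lines are dependent, hence so are their images, while the images of \<open>x\<close> and \<open>y\<close>
  remain independent.
\<close>

lemma image_collinear:
  assumes "R x x'" "R y y'" "R z z'" "lin_indep [x, y]" "z = a \<cdot> x + b \<cdot> y"
  obtains a' b' where "z' = a' \<cdot> x' + b' \<cdot> y'"
proof -
  have "lin_indep [x', y']"
    using lin_indep_iff[of "[x, y]" "[x', y']"] assms by simp
  moreover have "\<not> lin_indep [z, x, y]"
    using assms(5) by (auto simp: lin_indep_Cons in_span_pair)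
  then have "\<not> lin_indep [z', x', y']"
    using lin_indep_iff[of "[z, x, y]" "[z', x', y']"] assms by simp
  ultimately show thesis
    using that by (auto simp: lin_indep_Cons in_span_pair)
qed

end

section \<open>Lifting to a hyperplane\<close>

text \<open>
  The assumption \<open>rich\<close> says that \<open>W\<close> contains two independent vectors. The arguments below use it to
  move from a vector of \<open>W\<close> to one that is independent of it.
\<close>

locale framed_line_correspondence = line_correspondence scale Basis R
  for scale :: "'k::field \<Rightarrow> 'v::ab_group_add \<Rightarrow> 'v" (infixr "\<cdot>" 75) and Basis R +
  fixes W :: "'v set" and e b :: 'v
  assumes W: "subspace W"
    and rich: "x \<in> W \<Longrightarrow> \<exists>z\<in>W. \<forall>c. z \<noteq> c \<cdot> x"
    and e: "e \<notin> W"
    and Reb: "R e b"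
begin

text \<open>
  In the affine chart \<open>x \<mapsto> e + x\<close> of projective space, with the image normalised to lie in the chart
  through \<open>b\<close>, this is the given correspondence: the line of \<open>e + x\<close> goes to the line of \<open>b + lift x\<close>.
  The vector 0 spans no line, and the value there is the one that keeps this true: \<open>e\<close> goes to \<open>b\<close>.
\<close>

definition lift :: "'v \<Rightarrow> 'v" where
  "lift x = (if x = 0 then 0 else THE y. R x y \<and> R (e + x) (b + y))"

lemma lift_zero [simp]: "lift 0 = 0"
  by (simp add: lift_def)

lemma lin_indep_e:
  assumes "x \<in> W" "x \<noteq> 0" shows "lin_indep [e, x]"
  using e assms W by (auto simp: lin_indep_pair_iff subspace_scale)

lemma lin_indep_e2:
  assumes "x \<in> W" "y \<in> W" "lin_indep [x, y]" shows "lin_indep [e, x, y]"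
proof -
  have "span {x, y} \<subseteq> W"
    using assms W by (intro span_minimal) auto
  then show ?thesis
    using e assms by (auto simp: lin_indep_Cons)
qed

lemma lin_indep_b: "x \<in> W \<Longrightarrow> R x y \<Longrightarrow> lin_indep [b, y]"
  using lin_indep_iff[of "[e, x]" "[b, y]"] Reb lin_indep_e[of x] nonzero by simp

lemma lin_indep_b2:
  "x \<in> W \<Longrightarrow> y \<in> W \<Longrightarrow> lin_indep [x, y] \<Longrightarrow> R x x' \<Longrightarrow> R y y' \<Longrightarrow> lin_indep [b, x', y']"
  using lin_indep_iff[of "[e, x, y]" "[b, x', y']"] Reb lin_indep_e2[of x y] by simp

text \<open>
  Two candidates are proportional, say \<open>y' = c y\<close>, and so are \<open>b + y'\<close> and \<open>b + y\<close>; comparing the coefficients of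
  \<open>b\<close> and of \<open>y\<close> gives \<open>c = 1\<close>.
\<close>

lemma lift_eqI:
  assumes x: "x \<in> W" and y: "R x y" "R (e + x) (b + y)"
  shows "lift x = y"
proof -
  have "y' = y" if y': "R x y'" "R (e + x) (b + y')" for y'
  proof -
    obtain c where c: "y' = c \<cdot> y"
      using image_unique[OF y(1) y'(1)] by blast
    obtain d where d: "b + y' = d \<cdot> (b + y)"
      using image_unique[OF y(2) y'(2)] by blast
    have "1 \<cdot> b + c \<cdot> y = d \<cdot> b + d \<cdot> y"
      using c d by (simp add: scale_right_distrib)
    then have "c = 1"
      using lin_indep_pairD[OF lin_indep_b[OF x y(1)]] by metis
    then show ?thesis
      using c by simp
  qed
  then have "(THE y. R x y \<and> R (e + x) (b + y)) = y"
    using y by blast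
  then show ?thesis
    using nonzero[OF y(1)] by (simp add: lift_def)
qed

text \<open>
  The image of \<open>e + x\<close> is represented by some \<open>p b + q y\<close>. Both coefficients are nonzero since
  \<open>e + x\<close> is independent of \<open>x\<close> and of \<open>e\<close>, and dividing by \<open>p\<close> turns the coefficient of \<open>b\<close> into 1.
\<close>

lemma lift_spec:
  assumes x: "x \<in> W" "x \<noteq> 0"
  shows "R x (lift x) \<and> R (e + x) (b + lift x)"
proof -
  obtain y where y: "R x y"
    using total x by blast
  have "e + x \<noteq> 0"
    using e x W by (metis add_eq_0_iff subspace_neg minus_minus)
  then obtain u where u: "R (e + x) u"
    using total by blast
  obtain p q where pq: "u = p \<cdot> b + q \<cdot> y"
    by (rule image_collinear[OF Reb y u lin_indep_e[OF x], of 1 1]) auto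
  have "lin_indep [e + x, x]"
    using lin_indep_e[OF x] by (simp add: lin_indep_pair_iff) (metis add_diff_cancel_right' scale_left_diff_distrib scale_one)
  then have "lin_indep [u, y]"
    using lin_indep_iff[of "[e + x, x]" "[u, y]"] u y by simp
  then have p: "p \<noteq> 0"
    using pq by (auto simp: lin_indep_pair_iff)
  have "lin_indep [e + x, e]"
    using lin_indep_e[OF x] unfolding lin_indep_swap[of e x]
    by (simp add: lin_indep_pair_iff) (metis add_diff_cancel_left' scale_left_diff_distrib scale_one)
  then have "lin_indep [u, b]"
    using lin_indep_iff[of "[e + x, e]" "[u, b]"] u Reb by simp
  then have q: "q \<noteq> 0"
    using pq by (auto simp: lin_indep_pair_iff)
  have "R x ((q / p) \<cdot> y)" "R (e + x) (b + (q / p) \<cdot> y)"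
    using scale_right[OF y, of "q / p"] scale_right[OF u, of "1 / p"] p q pq
    by (simp_all add: scale_right_distrib)
  then show ?thesis
    using lift_eqI[OF x(1)] by metis
qed

lemma lift_nonzero: "x \<in> W \<Longrightarrow> x \<noteq> 0 \<Longrightarrow> lift x \<noteq> 0"
  using lift_spec nonzero by blast

text \<open>
  The line of \<open>e + x + y\<close> is the intersection of the plane of \<open>e + x\<close> and \<open>y\<close> with the plane of \<open>e + y\<close> and \<open>x\<close>. The
  image planes are spanned by \<open>b + lift x\<close>, \<open>lift y\<close> and by \<open>b + lift y\<close>, \<open>lift x\<close>, and they meet in the
  line of \<open>b + lift x + lift y\<close>.
\<close>

lemma lift_add_indep:
  assumes x: "x \<in> W" and y: "y \<in> W" and xy: "lin_indep [x, y]"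
  shows "lift (x + y) = lift x + lift y"
proof -
  have nz: "x \<noteq> 0" "y \<noteq> 0" "x + y \<in> W"
    using lin_indep_nonzero[OF xy] x y W by (auto simp: subspace_add)
  have "x + y \<noteq> 0"
    using lin_indep_pairD[OF xy, of 1 1 0 0] by auto
  note sx = lift_spec[OF x nz(1)] and sy = lift_spec[OF y nz(2)] and sxy = lift_spec[OF nz(3) this]
  have ind: "lin_indep [b, lift x, lift y]"
    using lin_indep_b2[OF x y xy] sx sy by blast
  let ?u = "b + lift (x + y)"
  have exy: "lin_indep [e, x, y]"
    using lin_indep_e2[OF x y xy] .
  have "e + x \<noteq> c \<cdot> y" "e + y \<noteq> c \<cdot> x" for c
    using lin_indep_tripleD[OF exy, of 1 1 0 0 0 c] lin_indep_tripleD[OF exy, of 1 0 1 0 c 0]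
    by auto
  then have "lin_indep [e + x, y]" "lin_indep [e + y, x]"
    unfolding lin_indep_pair_iff using nz(1,2) by blast+
  have eqs: "e + (x + y) = 1 \<cdot> (e + x) + 1 \<cdot> y" "e + (x + y) = 1 \<cdot> (e + y) + 1 \<cdot> x"
    "x + y = 1 \<cdot> x + 1 \<cdot> y"
    by (simp_all add: ac_simps)
  obtain p q where pq: "?u = p \<cdot> (b + lift x) + q \<cdot> lift y"
    using image_collinear[OF conjunct2[OF sx] conjunct1[OF sy] conjunct2[OF sxy]
        \<open>lin_indep [e + x, y]\<close> eqs(1)] by blast
  obtain r s where rs: "?u = r \<cdot> (b + lift y) + s \<cdot> lift x"
    using image_collinear[OF conjunct2[OF sy] conjunct1[OF sx] conjunct2[OF sxy]
        \<open>lin_indep [e + y, x]\<close> eqs(2)] by blast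
  obtain k l where kl: "lift (x + y) = k \<cdot> lift x + l \<cdot> lift y"
    using image_collinear[OF conjunct1[OF sx] conjunct1[OF sy] conjunct1[OF sxy] xy eqs(3)]
    by blast
  have "p \<cdot> b + p \<cdot> lift x + q \<cdot> lift y = r \<cdot> b + s \<cdot> lift x + r \<cdot> lift y"
    using pq rs by (simp add: algebra_simps)
  then have "p = r \<and> p = s \<and> q = r"
    by (rule lin_indep_tripleD[OF ind])
  moreover have "1 \<cdot> b + k \<cdot> lift x + l \<cdot> lift y = p \<cdot> b + p \<cdot> lift x + q \<cdot> lift y"
    using pq kl by (simp add: algebra_simps)
  then have "1 = p \<and> k = p \<and> l = q"
    by (rule lin_indep_tripleD[OF ind])
  ultimately show ?thesis
    using kl by simp
qed

text \<open>
  For proportional \<open>x\<close> and \<open>y\<close>, a vector \<open>z\<close> outside their line reduces the claim to the independent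
  case: \<open>x + y + z\<close> is split in the two ways \<open>x + (y + z)\<close> and \<open>(x + y) + z\<close>.
\<close>

lemma lift_add:
  assumes x: "x \<in> W" and y: "y \<in> W"
  shows "lift (x + y) = lift x + lift y"
proof (cases "x = 0 \<or> y = 0 \<or> lin_indep [x, y]")
  case True
  then show ?thesis
    using lift_add_indep x y by auto
next
  case False
  then obtain k where k: "x = k \<cdot> y" and nz: "x \<noteq> 0" "y \<noteq> 0"
    by (auto simp: lin_indep_pair_iff)
  obtain z where z: "z \<in> W" "\<forall>c. z \<noteq> c \<cdot> y"
    using rich y by blast
  have indz: "lin_indep [z, c \<cdot> y]" if "c \<noteq> 0" for c
    using z nz that by (auto simp: lin_indep_pair_iff)
  have "k \<noteq> 0"
    using nz k by auto
  have "lin_indep [y + z, x]"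
  proof -
    have "y + z \<noteq> c \<cdot> x" for c
      using z(2)[rule_format, of "c * k - 1"] by (auto simp: k algebra_simps)
    then show ?thesis
      using nz by (simp add: lin_indep_pair_iff)
  qed
  then have 1: "lift (x + (y + z)) = lift x + lift (y + z)"
    using x y z W by (intro lift_add_indep) (auto simp: lin_indep_swap[of x] subspace_add)
  have 2: "lift (y + z) = lift y + lift z"
    using y z indz[of 1] by (intro lift_add_indep) (auto simp: lin_indep_swap[of y])
  have 3: "lift ((x + y) + z) = lift (x + y) + lift z"
  proof (cases "x + y = 0")
    case False
    moreover have "x + y = (k + 1) \<cdot> y"
      by (simp add: k scale_left_distrib)
    ultimately have "lin_indep [z, x + y]"
      using indz[of "k + 1"] by auto
    then show ?thesis
      using x y z W by (intro lift_add_indep) (auto simp: lin_indep_swap[of "x + y"] subspace_add)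
  qed simp
  have "lift (x + y) + lift z = lift x + lift y + lift z"
    using 1 2 3 by (simp only: add.assoc)
  then show ?thesis
    by simp
qed

lemma lift_scale_ex:
  assumes "x \<in> W" shows "\<exists>d. lift (c \<cdot> x) = d \<cdot> lift x"
proof (cases "c = 0 \<or> x = 0")
  case True
  then show ?thesis
    by (intro exI[of _ 0]) auto
next
  case False
  then have "c \<cdot> x \<in> W" "c \<cdot> x \<noteq> 0"
    using assms W by (auto simp: subspace_scale)
  then have "R (c \<cdot> x) (lift (c \<cdot> x))" "R (c \<cdot> x) (lift x)"
    using lift_spec False assms scale_left by blast+
  then obtain d where "lift (c \<cdot> x) = d \<cdot> lift x"
    using image_unique by blast
  then show ?thesis
    by blast
qed

text \<open>
  The factors belonging to \<open>x\<close>, to \<open>y\<close> and to \<open>x + y\<close> agree, as seen by comparing coefficients in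
  \<open>lift (c x) + lift (c y) = lift (c (x + y))\<close>.
\<close>

lemma lift_scale_transfer_indep:
  assumes x: "x \<in> W" and y: "y \<in> W" and xy: "lin_indep [x, y]" and d: "lift (c \<cdot> x) = d \<cdot> lift x"
  shows "lift (c \<cdot> y) = d \<cdot> lift y"
proof -
  have nz: "x \<noteq> 0" "y \<noteq> 0"
    using lin_indep_nonzero[OF xy] by auto
  obtain d' where d': "lift (c \<cdot> y) = d' \<cdot> lift y"
    using lift_scale_ex[OF y] by blast
  obtain d'' where d'': "lift (c \<cdot> (x + y)) = d'' \<cdot> lift (x + y)"
    using lift_scale_ex x y W by (meson subspace_add)
  have "d \<cdot> lift x + d' \<cdot> lift y = d'' \<cdot> lift x + d'' \<cdot> lift y"
    using d d' d'' x y W by (simp add: scale_right_distrib lift_add subspace_scale)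
  moreover have "lin_indep [lift x, lift y]"
    using lin_indep_b2[OF x y xy, of "lift x" "lift y"] lift_spec x y nz by (auto simp: lin_indep_Cons)
  ultimately have "d = d'' \<and> d' = d''"
    by (rule lin_indep_pairD[rotated])
  then show ?thesis
    using d' by simp
qed

lemma lift_scale_transfer:
  assumes x: "x \<in> W" "x \<noteq> 0" and y: "y \<in> W" and d: "lift (c \<cdot> x) = d \<cdot> lift x"
  shows "lift (c \<cdot> y) = d \<cdot> lift y"
proof (cases "y = 0 \<or> lin_indep [x, y]")
  case True
  then show ?thesis
    using lift_scale_transfer_indep assms by auto
next
  case False
  then obtain k where k: "x = k \<cdot> y" and nz: "y \<noteq> 0"
    by (auto simp: lin_indep_pair_iff)
  obtain z where z: "z \<in> W" "\<forall>c. z \<noteq> c \<cdot> y"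
    using rich y by blast
  have "lin_indep [z, x]" "lin_indep [z, y]"
    using z x nz by (auto simp: lin_indep_pair_iff k)
  then show ?thesis
    using lift_scale_transfer_indep x y z d lin_indep_swap by metis
qed

definition scalar_map :: "'k \<Rightarrow> 'k" where
  "scalar_map c = (SOME d. \<forall>x\<in>W. lift (c \<cdot> x) = d \<cdot> lift x)"

lemma lift_scale: "x \<in> W \<Longrightarrow> lift (c \<cdot> x) = scalar_map c \<cdot> lift x"
proof -
  obtain z where z: "z \<in> W" "z \<noteq> 0"
    using rich[of 0] subspace_0[OF W] by auto
  obtain d where "lift (c \<cdot> z) = d \<cdot> lift z"
    using lift_scale_ex z by blast
  then have "\<exists>d. \<forall>x\<in>W. lift (c \<cdot> x) = d \<cdot> lift x"
    using lift_scale_transfer z by blast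
  then have "\<forall>x\<in>W. lift (c \<cdot> x) = scalar_map c \<cdot> lift x"
    unfolding scalar_map_def by (rule someI_ex)
  then show "x \<in> W \<Longrightarrow> lift (c \<cdot> x) = scalar_map c \<cdot> lift x"
    by blast
qed

lemma ex_W_nonzero: obtains x where "x \<in> W" "x \<noteq> 0" "lift x \<noteq> 0"
  using rich[of 0] subspace_0[OF W] lift_nonzero by auto

lemma scalar_map_add: "scalar_map (c + d) = scalar_map c + scalar_map d"
proof -
  obtain x where x: "x \<in> W" "x \<noteq> 0" "lift x \<noteq> 0"
    by (rule ex_W_nonzero)
  have "scalar_map (c + d) \<cdot> lift x = lift (c \<cdot> x + d \<cdot> x)"
    using lift_scale[OF x(1), of "c + d"] by (simp add: scale_left_distrib)
  also have "\<dots> = (scalar_map c + scalar_map d) \<cdot> lift x"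
    using x W by (simp add: lift_add lift_scale subspace_scale scale_left_distrib)
  finally show ?thesis
    using x by simp
qed

lemma scalar_map_mult: "scalar_map (c * d) = scalar_map c * scalar_map d"
proof -
  obtain x where x: "x \<in> W" "x \<noteq> 0" "lift x \<noteq> 0"
    by (rule ex_W_nonzero)
  have "scalar_map (c * d) \<cdot> lift x = lift (c \<cdot> d \<cdot> x)"
    using lift_scale[OF x(1), of "c * d"] by simp
  also have "\<dots> = scalar_map c \<cdot> scalar_map d \<cdot> lift x"
    using x W by (simp only: lift_scale subspace_scale)
  finally show ?thesis
    using x by simp
qed

lemma scalar_map_1 [simp]: "scalar_map 1 = 1"
proof -
  obtain x where x: "x \<in> W" "x \<noteq> 0" "lift x \<noteq> 0"
    by (rule ex_W_nonzero)
  then have "scalar_map 1 \<cdot> lift x = 1 \<cdot> lift x"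
    using lift_scale[OF x(1), of 1] by simp
  then show ?thesis
    using x scale_right_imp_eq by blast
qed

lemma scalar_map_0 [simp]: "scalar_map 0 = 0"
  using scalar_map_add[of 0 0] by (metis add.right_neutral add_left_cancel)

lemma scalar_map_eq_0_iff [simp]: "scalar_map c = 0 \<longleftrightarrow> c = 0"
  using scalar_map_mult[of c "inverse c"] by (cases "c = 0") auto

lemma inj_scalar_map: "inj scalar_map"
proof (rule injI)
  fix c d assume "scalar_map c = scalar_map d"
  then have "scalar_map (c - d) = 0"
    using scalar_map_add[of "c - d" d] by simp
  then show "c = d"
    by simp
qed

text \<open>
  The line of \<open>b + d lift x\<close> has a preimage, which lies in the plane of \<open>e\<close> and \<open>x\<close> but is not the line of \<open>x\<close>;
  so it contains some \<open>e + c x\<close>, whose image is the line of \<open>b + f(c) lift x\<close>.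
\<close>

lemma surj_scalar_map: "surj scalar_map"
proof -
  obtain x where x: "x \<in> W" "x \<noteq> 0" "lift x \<noteq> 0"
    by (rule ex_W_nonzero)
  note sx = lift_spec[OF x(1,2)]
  have "\<exists>c. d = scalar_map c" for d
  proof -
    have ind: "lin_indep [b, lift x]"
      using lin_indep_b x sx by blast
    have "b + d \<cdot> lift x \<noteq> 0"
      using lin_indep_pairD[OF ind, of 1 d 0 0] by auto
    then obtain v where v: "R v (b + d \<cdot> lift x)"
      using onto by blast
    obtain p q where pq: "v = p \<cdot> e + q \<cdot> x"
      by (rule line_correspondence.image_collinear[OF converse Reb _ v ind, of x 1 d])
        (use sx in auto)
    have "b + d \<cdot> lift x \<noteq> c \<cdot> lift x" for c
      using lin_indep_pairD[OF ind, of 1 d 0 c] by auto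
    then have "lin_indep [b + d \<cdot> lift x, lift x]"
      unfolding lin_indep_pair_iff using x(3) by blast
    then have "lin_indep [v, x]"
      using lin_indep_iff[of "[v, x]" "[b + d \<cdot> lift x, lift x]"] v sx by simp
    then have p: "p \<noteq> 0"
      using pq by (auto simp: lin_indep_pair_iff)
    define c where "c = q / p"
    have "R ((1 / p) \<cdot> v) (b + d \<cdot> lift x)"
      using scale_left v p by simp
    then have 1: "R (e + c \<cdot> x) (b + d \<cdot> lift x)"
      using p by (simp add: pq c_def scale_right_distrib)
    have "R (e + c \<cdot> x) (b + scalar_map c \<cdot> lift x)"
    proof (cases "c = 0")
      case False
      then show ?thesis
        using lift_spec[of "c \<cdot> x"] lift_scale[OF x(1), of c] x W by (simp add: subspace_scale)
    qed (use Reb in simp)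
    then obtain k where k: "b + d \<cdot> lift x = k \<cdot> (b + scalar_map c \<cdot> lift x)"
      using 1 image_unique by blast
    then have "1 \<cdot> b + d \<cdot> lift x = k \<cdot> b + (k * scalar_map c) \<cdot> lift x"
      by (simp add: scale_right_distrib)
    then show ?thesis
      using lin_indep_pairD[OF ind] by (metis mult_1)
  qed
  then show ?thesis
    by blast
qed

text \<open>
  Outside of \<open>W\<close> a line meets the affine chart \<open>e + W\<close>, where the image is known by \<open>lift_spec\<close>; rescaling
  by the coefficient of \<open>e\<close> gives the formula.
\<close>

lemma R_semilinear:
  assumes w: "w \<in> W" and nz: "z \<cdot> e + w \<noteq> 0"
  shows "R (z \<cdot> e + w) (scalar_map z \<cdot> b + lift w)"
proof (cases "z = 0")
  case True
  then show ?thesis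
    using lift_spec w nz by auto
next
  case False
  let ?w = "(1 / z) \<cdot> w"
  have w': "?w \<in> W"
    using w W by (simp add: subspace_scale)
  have "R (e + ?w) (b + lift ?w)"
    using lift_spec[OF w'] Reb by (cases "?w = 0") (simp_all del: scale_eq_0_iff)
  then have "R (z \<cdot> (e + ?w)) (scalar_map z \<cdot> (b + lift ?w))"
    using False by (simp add: scale_left scale_right)
  moreover have "scalar_map z \<cdot> lift ?w = lift w"
    using lift_scale[OF w', of z] False by simp
  ultimately show ?thesis
    using False by (simp add: scale_right_distrib)
qed

lemma lift_sum:
  assumes "\<And>i. i \<in> I \<Longrightarrow> u i \<in> W" "finite I"
  shows "lift (\<Sum>i\<in>I. z i \<cdot> u i) = (\<Sum>i\<in>I. scalar_map (z i) \<cdot> lift (u i))"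
  using assms(2,1)
proof (induction I)
  case (insert i I)
  then have "(\<Sum>i\<in>I. z i \<cdot> u i) \<in> W"
    using W by (intro subspace_sum) (auto simp: subspace_scale)
  then show ?case
    using insert W by (simp add: lift_add lift_scale subspace_scale)
qed simp

end

section \<open>The fundamental theorem of projective geometry\<close>

text \<open>
  The basis vector \<open>\<alpha> 0\<close> serves as \<open>e\<close>, the span of the others as \<open>W\<close>. Dimension at least 3 is
  what makes \<open>W\<close> at least two-dimensional.
\<close>

theorem (in line_correspondence) fundamental_theorem:
  assumes dim3: "dimension \<ge> 3" and \<alpha>: "lin_indep (map \<alpha> [0..<dimension])"
  obtains f \<beta> where "bij f" "\<And>c d. f (c + d) = f c + f d" "\<And>c d. f (c * d) = f c * f d"
    "lin_indep (map \<beta> [0..<dimension])"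
    "\<And>z. (\<Sum>i<dimension. z i \<cdot> \<alpha> i) \<noteq> 0 \<Longrightarrow>
       R (\<Sum>i<dimension. z i \<cdot> \<alpha> i) (\<Sum>i<dimension. f (z i) \<cdot> \<beta> i)"
proof -
  let ?n = dimension
  obtain m where m: "?n = Suc m" "m \<ge> 2"
    using dim3 by (cases ?n) auto
  define W where "W = span (\<alpha> ` {1..<?n})"
  have list: "[0..<?n] = 0 # [1..<?n]"
    using dim3 by (simp add: upt_conv_Cons)
  have e: "\<alpha> 0 \<notin> W"
    using \<alpha> unfolding list by (simp add: lin_indep_Cons W_def del: upt_Suc)
  (* Proportional basis vectors coincide: otherwise 1 and -c would be the coefficients of a relation. *)
  have \<alpha>_inj: "i = j" if "\<alpha> i = c \<cdot> \<alpha> j" "i < ?n" "j < ?n" for i j c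
  proof (rule ccontr)
    assume "i \<noteq> j"
    have "(\<Sum>l<?n. (if l = i then 1 else if l = j then - c else 0) \<cdot> \<alpha> l)
        = (\<Sum>l\<in>{i, j}. (if l = i then 1 else if l = j then - c else 0) \<cdot> \<alpha> l)"
      using that by (intro sum.mono_neutral_right) auto
    also have "\<dots> = 0"
      using that \<open>i \<noteq> j\<close> by simp
    finally show False
      using \<alpha>[unfolded lin_indep_iff_coeffs, rule_format, of "\<lambda>l. if l = i then 1 else if l = j then - c else 0" i]
        that by simp
  qed
  have "\<alpha> 0 \<noteq> 0"
    using e span_zero by (auto simp: W_def)
  then obtain b where b: "R (\<alpha> 0) b"
    using total by blast
  have rich: "\<exists>z\<in>W. \<forall>c. z \<noteq> c \<cdot> x" if "x \<in> W" for x
  proof (rule ccontr)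
    have in_W: "\<alpha> 1 \<in> W" "\<alpha> 2 \<in> W"
      using dim3 by (auto simp: W_def intro!: span_base)
    assume "\<not> ?thesis"
    then obtain c d where "\<alpha> 1 = c \<cdot> x" "\<alpha> 2 = d \<cdot> x"
      using in_W by meson
    moreover have "\<alpha> 2 \<noteq> 0"
      using \<alpha>_inj[of 2 0 1] dim3 by auto
    ultimately have "\<alpha> 1 = (c / d) \<cdot> \<alpha> 2"
      by (cases "d = 0") auto
    then show False
      using \<alpha>_inj[of 1 _ 2] dim3 by auto
  qed
  interpret framed_line_correspondence scale Basis R W "\<alpha> 0" b
    by unfold_locales (use e b rich in \<open>auto simp: W_def\<close>)
  define \<beta> where "\<beta> i = (if i = 0 then b else lift (\<alpha> i))" for i
  have mem: "\<alpha> (Suc i) \<in> W" if "i < m" for i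
    using that m by (auto simp: W_def intro!: span_base)
  have "list_all2 R (map \<alpha> [0..<?n]) (map \<beta> [0..<?n])"
  proof (clarsimp simp: list_all2_conv_all_nth simp del: upt_Suc)
    fix i assume i: "i < ?n"
    show "R (\<alpha> i) (\<beta> i)"
    proof (cases i)
      case 0
      then show ?thesis using b by (simp add: \<beta>_def)
    next
      case (Suc j)
      then show ?thesis
        using lift_spec[of "\<alpha> i"] mem[of j] \<alpha>_inj[of i 0 0] i m by (auto simp: \<beta>_def)
    qed
  qed
  then have "lin_indep (map \<beta> [0..<?n])"
    using lin_indep_iff \<alpha> by blast
  moreover have "R (\<Sum>i<?n. z i \<cdot> \<alpha> i) (\<Sum>i<?n. scalar_map (z i) \<cdot> \<beta> i)"
    if "(\<Sum>i<?n. z i \<cdot> \<alpha> i) \<noteq> 0" for z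
  proof -
    let ?w = "\<Sum>i<m. z (Suc i) \<cdot> \<alpha> (Suc i)"
    have "?w \<in> W"
      using mem W by (intro subspace_sum) (auto simp: subspace_scale)
    moreover have "(\<Sum>i<?n. z i \<cdot> \<alpha> i) = z 0 \<cdot> \<alpha> 0 + ?w"
      by (simp add: m sum.lessThan_Suc_shift del: sum.lessThan_Suc)
    moreover have "(\<Sum>i<?n. scalar_map (z i) \<cdot> \<beta> i) = scalar_map (z 0) \<cdot> b + lift ?w"
      using lift_sum[of "{..<m}" "\<lambda>i. \<alpha> (Suc i)" "\<lambda>i. z (Suc i)"] mem
      by (simp add: m sum.lessThan_Suc_shift \<beta>_def del: sum.lessThan_Suc)
    ultimately show ?thesis
      using R_semilinear that by metis
  qed
  ultimately show thesis
    using that[of scalar_map \<beta>] scalar_map_add scalar_map_mult inj_scalar_map surj_scalar_map by (simp add: bij_def)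
qed

section \<open>Complex inner product spaces\<close>

global_interpretation cvec_list: list_independence "scaleC :: complex \<Rightarrow> 'a \<Rightarrow> 'a::complex_inner"
  by unfold_locales

lemma cinner_zero_right [simp]: "cinner x 0 = 0"
  using cinner_scaleC_right[of x 0 0] by simp

lemma cinner_zero_left [simp]: "cinner 0 x = 0"
  using cinner_commute[of 0 x] by simp

lemma cinner_add_left: "cinner (x + y) z = cinner x z + cinner y z"
  using cinner_commute[of "x + y" z] cinner_commute[of x z] cinner_commute[of y z]
  by (simp add: cinner_add_right)

lemma cinner_scaleC_left: "cinner (a *\<^sub>C x) y = cnj a * cinner x y"
  using cinner_commute[of "a *\<^sub>C x" y] cinner_commute[of x y]
  by (simp add: cinner_scaleC_right)

lemma cinner_diff_right: "cinner x (y - z) = cinner x y - cinner x z"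
  using cinner_add_right[of x "y - z" z] by simp

lemma cinner_sum_right: "cinner x (\<Sum>i\<in>I. u i) = (\<Sum>i\<in>I. cinner x (u i))"
  by (induction I rule: infinite_finite_induct) (simp_all add: cinner_add_right)

lemma cinner_self: "cinner x x = complex_of_real ((norm x)\<^sup>2)"
proof -
  have "Im (cinner x x) = 0"
    using cinner_commute[of x x] by (simp add: complex_eq_iff)
  then show ?thesis
    using cinner_ge_zero[of x] by (simp add: complex_eq_iff norm_eq_sqrt_cinner)
qed

lemma norm_scaleC: "norm (a *\<^sub>C x) = cmod a * norm x"
proof -
  have "complex_of_real ((norm (a *\<^sub>C x))\<^sup>2) = cnj a * a * complex_of_real ((norm x)\<^sup>2)"
    by (simp add: cinner_self[symmetric] cinner_scaleC_left cinner_scaleC_right del: of_real_power)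
  also have "cnj a * a = complex_of_real ((cmod a)\<^sup>2)"
    using complex_norm_square[of a] by (simp add: mult.commute)
  finally have "(norm (a *\<^sub>C x))\<^sup>2 = (cmod a * norm x)\<^sup>2"
    by (simp only: of_real_mult[symmetric] of_real_eq_iff power_mult_distrib)
  then show ?thesis
    by (simp add: power2_eq_iff_nonneg)
qed

text \<open>
  \<open>c x\<close> is the orthogonal projection of \<open>y\<close> to the line of \<open>x\<close>, and by Pythagoras it is no longer than \<open>y\<close>.
\<close>

lemma cauchy_schwarz: "cmod (cinner x y) \<le> norm x * norm y"
proof (cases "x = 0")
  case False
  define c where "c = cinner x y / cinner x x"
  define u where "u = y - c *\<^sub>C x"
  have xx: "cinner x x \<noteq> 0"
    using False by (simp add: cinner_eq_zero_iff)
  have xu: "cinner x u = 0"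
    using xx by (simp add: u_def c_def cinner_diff_right cinner_scaleC_right)
  then have ux: "cinner u x = 0"
    using cinner_commute[of u x] by simp
  have "y = u + c *\<^sub>C x"
    by (simp add: u_def)
  then have "cinner y y = cinner u u + cinner (c *\<^sub>C x) (c *\<^sub>C x)"
    using xu ux by (simp add: cinner_add_left cinner_add_right cinner_scaleC_left cinner_scaleC_right)
  then have "complex_of_real ((norm y)\<^sup>2) = complex_of_real ((norm u)\<^sup>2 + (norm (c *\<^sub>C x))\<^sup>2)"
    by (simp only: cinner_self of_real_add)
  then have "(norm y)\<^sup>2 = (norm u)\<^sup>2 + (norm (c *\<^sub>C x))\<^sup>2"
    by (simp only: of_real_eq_iff)
  then have "norm (c *\<^sub>C x) \<le> norm y"
    by (simp add: power2_le_imp_le)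
  moreover have "cmod (cinner x y) = norm x * norm (c *\<^sub>C x)"
    using False by (simp add: norm_scaleC c_def cinner_self norm_divide norm_power norm_mult power2_eq_square)
  ultimately show ?thesis
    by (simp add: mult_left_mono)
qed simp

lemma bounded_ops_dyad: "(\<lambda>v. cinner x v *\<^sub>C y) \<in> bounded_ops"
proof -
  have "bounded_linear (\<lambda>v. cinner x v *\<^sub>C y)"
  proof (rule bounded_linear_intro)
    show "norm (cinner x v *\<^sub>C y) \<le> norm v * (norm x * norm y)" for v
      using mult_right_mono[OF cauchy_schwarz[of x v], of "norm y"]
      by (simp add: norm_scaleC mult.commute mult.left_commute)
  qed (simp_all add: cinner_add_right scaleC_add_left scaleR_scaleC cinner_scaleC_right scaleC_scaleC)
  then show ?thesis
    by (simp add: bounded_ops_def cinner_scaleC_right scaleC_scaleC)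
qed

lemma bounded_ops_scaleC:
  assumes "T \<in> bounded_ops" shows "(\<lambda>v. c *\<^sub>C T v) \<in> bounded_ops"
proof -
  have "bounded_linear (\<lambda>v. c *\<^sub>C v :: 'a)"
    by (rule bounded_linear_intro[of _ "cmod c"])
      (simp_all add: scaleC_add_right scaleR_scaleC scaleC_scaleC norm_scaleC mult.commute)
  then have "bounded_linear (\<lambda>v. c *\<^sub>C T v)"
    using assms by (auto simp: bounded_ops_def intro: bounded_linear_compose)
  then show ?thesis
    using assms by (simp add: bounded_ops_def scaleC_scaleC mult.commute)
qed

lemma bounded_ops_sum:
  assumes "\<And>i. i \<in> I \<Longrightarrow> T i \<in> bounded_ops"
  shows "(\<lambda>v. \<Sum>i\<in>I. T i v) \<in> bounded_ops"
  using assms by (auto simp: bounded_ops_def cvec.scale_sum_right intro!: bounded_linear_sum)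

section \<open>Rank one projections\<close>

definition line_proj :: "'a::complex_inner \<Rightarrow> 'a \<Rightarrow> 'a" where
  "line_proj x v = (cinner x v / cinner x x) *\<^sub>C x"

lemma line_proj_bounded: "line_proj x \<in> bounded_ops"
proof -
  have "line_proj x = (\<lambda>v. (1 / cinner x x) *\<^sub>C cinner x v *\<^sub>C x)"
    by (simp add: fun_eq_iff line_proj_def scaleC_scaleC)
  then show ?thesis
    using bounded_ops_scaleC[OF bounded_ops_dyad[of x x]] by metis
qed

lemma line_proj_self [simp]: "line_proj x x = x"
  by (cases "x = 0") (simp_all add: line_proj_def cinner_eq_zero_iff scaleC_one)

lemma line_proj_scaleC_arg: "line_proj x (c *\<^sub>C v) = c *\<^sub>C line_proj x v"
  by (simp add: line_proj_def cinner_scaleC_right scaleC_scaleC)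

lemma range_line_proj: "range (line_proj x) = range (\<lambda>c. c *\<^sub>C x)"
proof (safe)
  fix v show "line_proj x v \<in> range (\<lambda>c. c *\<^sub>C x)"
    by (auto simp: line_proj_def)
next
  fix c show "c *\<^sub>C x \<in> range (line_proj x)"
    by (metis line_proj_scaleC_arg line_proj_self rangeI)
qed

lemma line_proj_scaleC: "c \<noteq> 0 \<Longrightarrow> line_proj (c *\<^sub>C x) = line_proj x"
  by (auto simp: fun_eq_iff line_proj_def cinner_scaleC_left cinner_scaleC_right scaleC_scaleC)

lemma line_proj_eqI:
  assumes "x = c *\<^sub>C y" "x \<noteq> 0" shows "line_proj x = line_proj y"
  using assms line_proj_scaleC[of c y] by (cases "c = 0") auto

lemma line_proj_rank_one: assumes "x \<noteq> 0" shows "line_proj x \<in> rank_one_projections"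
proof -
  have "cinner (line_proj x v) w = cinner v (line_proj x w)" for v w
    using cinner_commute[of v x] cinner_commute[of x x]
    by (simp add: line_proj_def cinner_scaleC_left cinner_scaleC_right)
  moreover have "line_proj x (line_proj x v) = line_proj x v" for v
    by (simp only: line_proj_def[of x v] line_proj_scaleC_arg line_proj_self)
  moreover have "cvec.dim (range (line_proj x)) = 1"
  proof -
    have "cvec.independent {x}"
      using assms by simp
    moreover have "range (line_proj x) = cvec.span {x}"
      by (simp add: range_line_proj cvec.span_singleton)
    ultimately show ?thesis
      using cvec.dim_eq_card[of "{x}"] by (simp add: cvec.dim_span)
  qed
  ultimately show ?thesis
    using line_proj_bounded by (simp add: rank_one_projections_def fun_eq_iff)
qed

text \<open>
  \<open>P\<close> maps \<open>v\<close> to some \<open>c x\<close>, where \<open>x\<close> spans the range; self-adjointness and \<open>P x = x\<close> determine \<open>c\<close> through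
  \<open>cinner x v = cinner x (P v)\<close>.
\<close>

lemma rank_one_projection_cases:
  assumes P: "P \<in> rank_one_projections"
  obtains x where "x \<noteq> 0" "P = line_proj x"
proof -
  obtain B where B: "B \<subseteq> range P" "cvec.independent B" "range P \<subseteq> cvec.span B" "card B = 1"
    using cvec.basis_exists[of "range P"] P by (auto simp: rank_one_projections_def)
  then obtain x where x: "B = {x}"
    using card_1_singletonE by blast
  have idem: "P (P v) = P v" and self: "cinner (P v) w = cinner v (P w)" for v w
    using P by (auto simp: rank_one_projections_def fun_eq_iff)
  have x0: "x \<noteq> 0"
    using B x cvec.dependent_zero by auto
  have Px: "P x = x"
    using B x idem by auto
  have "P v = line_proj x v" for v
  proof -
    obtain c where c: "P v = c *\<^sub>C x"
      using B x by (auto simp: cvec.span_singleton)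
    then have "cinner x v = c * cinner x x"
      using self[of x v] Px by (simp add: cinner_scaleC_right)
    then show ?thesis
      using c x0 by (simp add: line_proj_def cinner_eq_zero_iff)
  qed
  then show thesis
    using that x0 by blast
qed

section \<open>Orthonormal bases\<close>

lemma finite_dimensional_of_dim:
  assumes "cvec.dim (UNIV :: 'a::complex_inner set) = n" "0 < n"
  obtains B :: "'a::complex_inner set" where
    "finite_dimensional_list_independence (scaleC :: complex \<Rightarrow> 'a \<Rightarrow> 'a::complex_inner) B" "card B = n"
proof -
  obtain B :: "'a set" where B: "cvec.independent B" "UNIV \<subseteq> cvec.span B" "card B = n"
    using cvec.basis_exists[of "UNIV :: 'a set"] assms by auto
  then have "finite B"
    using assms by (metis card.infinite less_irrefl)
  then have "finite_dimensional_list_independence (scaleC :: complex \<Rightarrow> 'a \<Rightarrow> 'a::complex_inner) B"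
    using B by unfold_locales auto
  then show thesis
    using that B by blast
qed

lemma cinner_orthonormal_combination:
  fixes i k :: nat
  assumes on: "\<And>i j. i < k \<Longrightarrow> j < k \<Longrightarrow> cinner (\<alpha> i) (\<alpha> j) = (if i = j then 1 else 0)" and i: "i < k"
  shows "cinner (\<alpha> i) (\<Sum>j<k. c j *\<^sub>C \<alpha> j) = c i"
proof -
  have "cinner (\<alpha> i) (\<Sum>j<k. c j *\<^sub>C \<alpha> j) = (\<Sum>j<k. c j * cinner (\<alpha> i) (\<alpha> j))"
    by (simp add: cinner_sum_right cinner_scaleC_right)
  also have "\<dots> = (\<Sum>j<k. if i = j then c j else 0)"
    by (rule sum.cong) (use on i in auto)
  finally show ?thesis
    using i by simp
qed

lemma orthonormal_independent:
  assumes on: "\<And>i j. i < k \<Longrightarrow> j < k \<Longrightarrow> cinner (\<alpha> i) (\<alpha> j) = (if i = j then 1 else 0)"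
  shows "cvec_list.lin_indep (map \<alpha> [0..<k])"
  unfolding cvec_list.lin_indep_iff_coeffs
proof (intro allI impI)
  fix c i
  assume s: "(\<Sum>i<length (map \<alpha> [0..<k]). c i *\<^sub>C (map \<alpha> [0..<k] ! i)) = 0"
    and "i < length (map \<alpha> [0..<k])"
  then have i: "i < k"
    by simp
  have "(\<Sum>j<k. c j *\<^sub>C \<alpha> j) = 0"
    using s by simp
  then show "c i = 0"
    using cinner_orthonormal_combination[OF on i, of c] by simp
qed

lemma orthonormal_basis_coeff:
  assumes \<alpha>: "is_orthonormal_basis n \<alpha>" and "i < n"
  shows "cinner (\<alpha> i) (\<Sum>j<n. c j *\<^sub>C \<alpha> j) = c i"
  using assms by (intro cinner_orthonormal_combination) (auto simp: is_orthonormal_basis_def)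

lemma orthonormal_basis_expansion:
  assumes \<alpha>: "is_orthonormal_basis n \<alpha>"
  shows "v = (\<Sum>i<n. cinner (\<alpha> i) v *\<^sub>C \<alpha> i)"
proof -
  have "v \<in> cvec.span (set (map \<alpha> [0..<n]))"
    using \<alpha> by (simp add: is_orthonormal_basis_def is_basis_def atLeast0LessThan)
  then obtain c where "v = (\<Sum>i<length (map \<alpha> [0..<n]). c i *\<^sub>C (map \<alpha> [0..<n] ! i))"
    unfolding cvec_list.in_span_set_list by blast
  then have "v = (\<Sum>i<n. c i *\<^sub>C \<alpha> i)"
    by simp
  then show ?thesis
    using orthonormal_basis_coeff[OF \<alpha>] by simp
qed

context
  fixes B :: "'a::complex_inner set" and n
  assumes fd: "finite_dimensional_list_independence (scaleC :: complex \<Rightarrow> 'a \<Rightarrow> 'a::complex_inner) B"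
    and card_B: "card B = n"
begin

interpretation fd: finite_dimensional_list_independence "scaleC :: complex \<Rightarrow> 'a \<Rightarrow> 'a::complex_inner" B
  by (rule fd)

lemma dimension_eq: "fd.dimension = n"
  by (simp add: fd.dimension_def card_B)

lemma is_basis_iff_lin_indep:
  "is_basis n (b :: nat \<Rightarrow> 'a) \<longleftrightarrow> cvec_list.lin_indep (map b [0..<n])"
proof -
  have "cvec.span (b ` {..<n}) = UNIV" if "cvec_list.lin_indep (map b [0..<n])"
    using fd.span_eq_UNIV_if_lin_indep[OF that] by (simp add: dimension_eq atLeast0LessThan)
  then show ?thesis
    by (auto simp: is_basis_def cvec_list.lin_indep_def distinct_map atLeast0LessThan)
qed

text \<open>
  Gram-Schmidt: fewer than \<open>n\<close> vectors do not span, and a vector outside their span is orthogonalised and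
  normalised.
\<close>

lemma orthonormal_basis_exists: "\<exists>\<alpha> :: nat \<Rightarrow> 'a. is_orthonormal_basis n \<alpha>"
proof -
  have "\<exists>\<alpha> :: nat \<Rightarrow> 'a. \<forall>i<k. \<forall>j<k. cinner (\<alpha> i) (\<alpha> j) = (if i = j then 1 else 0)" if "k \<le> n" for k
    using that
  proof (induction k)
    case (Suc k)
    then obtain \<alpha> :: "nat \<Rightarrow> 'a" where \<alpha>: "\<And>i j. i < k \<Longrightarrow> j < k \<Longrightarrow> cinner (\<alpha> i) (\<alpha> j) = (if i = j then 1 else 0)"
      by force
    have "cvec.span (set (map \<alpha> [0..<k])) \<noteq> UNIV"
      using fd.lin_indep_if_span_eq_UNIV(2)[of "map \<alpha> [0..<k]"] Suc.prems by (auto simp: dimension_eq)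
    then obtain v where v: "v \<notin> cvec.span (\<alpha> ` {..<k})"
      by (auto simp: atLeast0LessThan)
    define u where "u = v - (\<Sum>i<k. cinner (\<alpha> i) v *\<^sub>C \<alpha> i)"
    have "(\<Sum>i<k. cinner (\<alpha> i) v *\<^sub>C \<alpha> i) \<in> cvec.span (\<alpha> ` {..<k})"
      by (intro cvec.span_sum cvec.span_scale cvec.span_base) auto
    then have u0: "u \<noteq> 0"
      using v by (auto simp: u_def)
    have orth: "cinner (\<alpha> i) u = 0" if "i < k" for i
      using cinner_orthonormal_combination[OF \<alpha> that, of "\<lambda>j. cinner (\<alpha> j) v"]
      by (simp add: u_def cinner_diff_right)
    define w where "w = complex_of_real (1 / norm u) *\<^sub>C u"
    have ww: "cinner w w = 1"
      using u0 by (simp add: w_def cinner_self norm_scaleC norm_divide)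
    have aw: "cinner (\<alpha> i) w = 0" "cinner w (\<alpha> i) = 0" if "i < k" for i
      using orth[OF that] cinner_commute[of w "\<alpha> i"] by (simp_all add: w_def cinner_scaleC_right)
    show ?case
      by (rule exI[of _ "\<alpha>(k := w)"]) (auto simp: less_Suc_eq \<alpha> ww aw)
  qed simp
  then obtain \<alpha> :: "nat \<Rightarrow> 'a"
    where \<alpha>: "\<And>i j. i < n \<Longrightarrow> j < n \<Longrightarrow> cinner (\<alpha> i) (\<alpha> j) = (if i = j then 1 else 0)"
    by (meson order_refl)
  then show ?thesis
    using orthonormal_independent[of n \<alpha>] by (auto simp: is_orthonormal_basis_def is_basis_iff_lin_indep)
qed

section \<open>The joint spectrum of rank one projections\<close>

text \<open>
  In an orthonormal basis a linear map is a finite sum of the bounded operators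
  \<open>v \<mapsto> cinner (\<alpha> i) v T (\<alpha> i)\<close>. This makes the algebraic inverse of an operator bounded.
\<close>

lemma linear_imp_bounded_op:
  assumes add: "\<And>x y. T (x + y) = T x + T y" and scale: "\<And>c x. T (c *\<^sub>C x) = c *\<^sub>C T (x :: 'a)"
  shows "T \<in> bounded_ops"
proof -
  obtain \<alpha> :: "nat \<Rightarrow> 'a" where \<alpha>: "is_orthonormal_basis n \<alpha>"
    using orthonormal_basis_exists by blast
  have T0: "T 0 = 0"
    using scale[of 0 0] by simp
  have "T v = (\<Sum>i<n. cinner (\<alpha> i) v *\<^sub>C T (\<alpha> i))" for v
  proof -
    have "T (\<Sum>i<k. cinner (\<alpha> i) v *\<^sub>C \<alpha> i) = (\<Sum>i<k. cinner (\<alpha> i) v *\<^sub>C T (\<alpha> i))" for k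
      by (induction k) (simp_all add: T0 add scale)
    then show ?thesis
      using orthonormal_basis_expansion[OF \<alpha>, of v] by metis
  qed
  then have "T = (\<lambda>v. \<Sum>i<n. cinner (\<alpha> i) v *\<^sub>C T (\<alpha> i))"
    by blast
  then show ?thesis
    using bounded_ops_sum[of "{..<n}" "\<lambda>i v. cinner (\<alpha> i) v *\<^sub>C T (\<alpha> i)"] bounded_ops_dyad by metis
qed

lemma invertible_op_iff_inj:
  assumes T: "(T :: 'a \<Rightarrow> 'a) \<in> bounded_ops"
  shows "invertible_op T \<longleftrightarrow> inj T"
proof
  assume "invertible_op T"
  then show "inj T"
    by (metis invertible_op_def inj_on_id inj_on_imageI2)
next
  assume inj: "inj T"
  have add: "T (x + y) = T x + T y" and scale: "T (c *\<^sub>C x) = c *\<^sub>C T x" for x y c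
    using T by (auto simp: bounded_ops_def bounded_linear.linear linear_add)
  have "Vector_Spaces.linear scaleC scaleC T"
    unfolding Vector_Spaces.linear_iff using add scale cvec.vector_space_axioms by blast
  then have "surj T"
    using inj by (rule fd.linear_inj_imp_surj)
  then have inv: "T (inv T x) = x" "inv T (T x) = x" for x
    using inj by (simp_all add: surj_f_inv_f)
  have "inv T \<in> bounded_ops"
  proof (rule linear_imp_bounded_op)
    fix x y c
    have "inv T (x + y) = inv T (T (inv T x + inv T y))"
      by (simp only: add inv)
    then show "inv T (x + y) = inv T x + inv T y"
      by (simp only: inv)
    have "inv T (c *\<^sub>C x) = inv T (T (c *\<^sub>C inv T x))"
      by (simp only: scale inv)
    then show "inv T (c *\<^sub>C x) = c *\<^sub>C inv T x"
      by (simp only: inv)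
  qed
  moreover have "T \<circ> inv T = id" "inv T \<circ> T = id"
    by (simp_all add: fun_eq_iff inv)
  ultimately show "invertible_op T"
    unfolding invertible_op_def using T by blast
qed

text \<open>
  Only the \<open>xs ! i\<close> with \<open>c i \<noteq> 0\<close> contribute to the range; if they span then there must be \<open>n\<close> of them. Conversely,
  if the list is a basis then a kernel vector has zero inner product with each of its entries.
\<close>

lemma invertible_line_proj_combination_iff:
  assumes len: "length xs = n" and nz: "0 \<notin> set xs"
  shows "invertible_op (\<lambda>v. \<Sum>i<n. c i *\<^sub>C line_proj (xs ! i) v :: 'a) \<longleftrightarrow>
    (\<forall>i<n. c i \<noteq> 0) \<and> cvec_list.lin_indep xs"
    (is "invertible_op ?T \<longleftrightarrow> _")
proof
  assume "invertible_op ?T"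
  then obtain S where S: "?T \<circ> S = id"
    unfolding invertible_op_def by blast
  have surj: "?T (S w) = w" for w
    using fun_cong[OF S, of w] by simp
  define I where "I = filter (\<lambda>i. c i \<noteq> 0) [0..<n]"
  have in_span: "?T v \<in> cvec.span (set (map ((!) xs) I))" for v
  proof (rule cvec.span_sum)
    fix i assume i: "i \<in> {..<n}"
    show "c i *\<^sub>C line_proj (xs ! i) v \<in> cvec.span (set (map ((!) xs) I))"
    proof (cases "c i = 0")
      case False
      then have "xs ! i \<in> cvec.span (set (map ((!) xs) I))"
        using i by (intro cvec.span_base) (simp add: I_def)
      then show ?thesis
        unfolding line_proj_def by (intro cvec.span_scale)
    qed (simp add: cvec.span_zero)
  qed
  have "w \<in> cvec.span (set (map ((!) xs) I))" for w
    using in_span[of "S w"] unfolding surj .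
  then have span: "cvec.span (set (map ((!) xs) I)) = UNIV"
    by blast
  have "length (map ((!) xs) I) \<le> n"
    using length_filter_le[of _ "[0..<n]"] by (simp add: I_def)
  then have ind: "cvec_list.lin_indep (map ((!) xs) I)" and "length I = n"
    using fd.lin_indep_if_span_eq_UNIV[OF span] by (simp_all add: dimension_eq)
  then have "length (filter (\<lambda>i. c i \<noteq> 0) [0..<n]) = length [0..<n]"
    by (simp add: I_def)
  then have all: "\<forall>i<n. c i \<noteq> 0"
    using length_filter_less[of _ "[0..<n]" "\<lambda>i. c i \<noteq> 0"] by fastforce
  then have "map ((!) xs) I = xs"
    using map_nth[of xs] len by (simp add: I_def)
  then show "(\<forall>i<n. c i \<noteq> 0) \<and> cvec_list.lin_indep xs"
    using all ind by simp
next
  assume *: "(\<forall>i<n. c i \<noteq> 0) \<and> cvec_list.lin_indep xs"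
  have bd: "?T \<in> bounded_ops"
    by (intro bounded_ops_sum bounded_ops_scaleC line_proj_bounded)
  have ker: "v = 0" if "?T v = 0" for v
  proof -
    have sum: "(\<Sum>i<length xs. (c i * (cinner (xs ! i) v / cinner (xs ! i) (xs ! i))) *\<^sub>C (xs ! i)) = 0"
      using that by (simp add: line_proj_def scaleC_scaleC len)
    have "c i * (cinner (xs ! i) v / cinner (xs ! i) (xs ! i)) = 0" if "i < n" for i
      using cvec_list.lin_indep_coeffsD[OF conjunct2[OF *] sum, of i] that len by simp
    moreover have "cinner (xs ! i) (xs ! i) \<noteq> 0" if "i < n" for i
      using nz that len by (metis cinner_eq_zero_iff nth_mem)
    ultimately have perp: "cinner v (xs ! i) = 0" if "i < n" for i
      using * that len cinner_commute[of v "xs ! i"] by simp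
    have "v \<in> cvec.span (set xs)"
      using fd.span_eq_UNIV_if_lin_indep[of xs] * len by (simp add: dimension_eq)
    then obtain d where d: "v = (\<Sum>i<length xs. d i *\<^sub>C (xs ! i))"
      unfolding cvec_list.in_span_set_list by blast
    have "cinner v v = (\<Sum>i<length xs. d i * cinner v (xs ! i))"
      by (subst (2) d) (simp add: cinner_sum_right cinner_scaleC_right)
    also have "\<dots> = 0"
      using perp len by simp
    finally show ?thesis
      by (simp add: cinner_eq_zero_iff)
  qed
  have diff: "?T (x - y) = ?T x - ?T y" for x y
    using bd by (simp add: bounded_ops_def bounded_linear.linear linear_diff[of ?T])
  have "inj ?T"
  proof (rule injI)
    fix x y assume "?T x = ?T y"
    then have "?T (x - y) = 0"
      unfolding diff by (simp only: diff_self)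
    then show "x = y"
      using ker[of "x - y"] by simp
  qed
  then show "invertible_op ?T"
    using invertible_op_iff_inj[OF bd] by blast
qed

lemma joint_spectrum_line_proj:
  assumes "length xs = n" "0 \<notin> set (xs :: 'a list)"
  shows "joint_spectrum (map line_proj xs) =
    {cs. length cs = n \<and> \<not> ((\<forall>i<n. cs ! i \<noteq> 0) \<and> cvec_list.lin_indep xs)}"
proof -
  have "(\<Sum>i<length (map line_proj xs). cs ! i *\<^sub>C (map line_proj xs ! i) v) =
      (\<Sum>i<n. cs ! i *\<^sub>C line_proj (xs ! i) v)" for cs v
    using assms by simp
  then show ?thesis
    unfolding joint_spectrum_def using assms invertible_line_proj_combination_iff[OF assms] by simp
qed

text \<open>
  The tuple \<open>(1, \<dots>, 1)\<close> decides whether the lines are independent.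
\<close>

lemma joint_spectrum_line_proj_eq_iff:
  assumes "length xs = n" "0 \<notin> set (xs :: 'a list)" "length ys = n" "0 \<notin> set (ys :: 'a list)"
  shows "joint_spectrum (map line_proj xs) = joint_spectrum (map line_proj ys) \<longleftrightarrow>
    (cvec_list.lin_indep xs \<longleftrightarrow> cvec_list.lin_indep ys)"
proof
  assume "joint_spectrum (map line_proj xs) = joint_spectrum (map line_proj ys)"
  then have "replicate n 1 \<in> joint_spectrum (map line_proj xs) \<longleftrightarrow>
      replicate n 1 \<in> joint_spectrum (map line_proj ys)"
    by simp
  then show "cvec_list.lin_indep xs \<longleftrightarrow> cvec_list.lin_indep ys"
    by (auto simp: joint_spectrum_line_proj assms)
qed (simp add: joint_spectrum_line_proj assms)

end

section \<open>Semilinear maps and the characterisation\<close>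

text \<open>
  The coordinates of \<open>g x\<close> in the basis \<open>\<beta>\<close> are the images under \<open>f\<close> of the coordinates \<open>cinner (\<alpha> i) x\<close>.
\<close>

lemma semilinear_extension:
  assumes \<alpha>: "is_orthonormal_basis n \<alpha>" and \<beta>: "is_basis n \<beta>" and f: "ring_automorphism f"
    and g: "\<forall>z. g (\<Sum>i<n. z i *\<^sub>C \<alpha> i) = (\<Sum>i<n. f (z i) *\<^sub>C \<beta> i)"
  shows "g (x + y) = g x + g y" and "g (c *\<^sub>C x) = f c *\<^sub>C g x" and "g x = 0 \<longleftrightarrow> x = 0"
    and "surj f" and "f c = 0 \<longleftrightarrow> c = 0"
proof -
  have f_hom: "f (a + b) = f a + f b" "f (a * b) = f a * f b" for a b
    using f by (auto simp: ring_automorphism_def)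
  have f0: "f 0 = 0"
    using f_hom(1)[of 0 0] by simp
  have "inj f" and surj: "surj f"
    using f by (auto simp: ring_automorphism_def bij_def)
  then have f_zero: "f a = 0 \<longleftrightarrow> a = 0" for a
    using f0 by (metis injD)
  have g_eq: "g v = (\<Sum>i<n. f (cinner (\<alpha> i) v) *\<^sub>C \<beta> i)" for v
    using g[rule_format, of "\<lambda>i. cinner (\<alpha> i) v"] orthonormal_basis_expansion[OF \<alpha>, of v] by simp
  show "g (x + y) = g x + g y"
    by (simp add: g_eq cinner_add_right f_hom scaleC_add_left sum.distrib)
  show "g (c *\<^sub>C x) = f c *\<^sub>C g x"
    by (simp add: g_eq cinner_scaleC_right f_hom cvec.scale_sum_right scaleC_scaleC)
  show "g x = 0 \<longleftrightarrow> x = 0"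
  proof
    assume "g x = 0"
    then have sum: "(\<Sum>i<length (map \<beta> [0..<n]). f (cinner (\<alpha> i) x) *\<^sub>C (map \<beta> [0..<n] ! i)) = 0"
      by (simp add: g_eq)
    have "cvec_list.lin_indep (map \<beta> [0..<n])"
      using \<beta> by (simp add: is_basis_def cvec_list.lin_indep_def distinct_map atLeast0LessThan)
    then have "f (cinner (\<alpha> i) x) = 0" if "i < n" for i
      using cvec_list.lin_indep_coeffsD[OF _ sum] that by simp
    then have "\<forall>i<n. cinner (\<alpha> i) x = 0"
      by (simp add: f_zero)
    then show "x = 0"
      using orthonormal_basis_expansion[OF \<alpha>, of x] by simp
  qed (simp add: g_eq f0)
  show "surj f" "f c = 0 \<longleftrightarrow> c = 0"
    by (rule surj) (rule f_zero)
qed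

lemma semilinear_image_range_line_proj:
  assumes scale: "\<And>c x. g (c *\<^sub>C x) = f c *\<^sub>C g x" and f: "surj f"
  shows "{g (line_proj x \<xi>) | \<xi>. True} = range (line_proj (g x))"
proof -
  have "{g (line_proj x \<xi>) | \<xi>. True} = g ` range (\<lambda>c. c *\<^sub>C x)"
    unfolding range_line_proj[symmetric] by auto
  also have "\<dots> = (\<lambda>c. c *\<^sub>C g x) ` range f"
    by (simp add: image_image scale)
  finally show ?thesis
    by (simp add: range_line_proj f)
qed

lemma line_proj_eq_if_range_eq:
  assumes "x \<noteq> 0" "range (line_proj x) = range (line_proj y)"
  shows "line_proj x = line_proj y"
proof -
  have "x \<in> range (line_proj x)"
    by (metis line_proj_self rangeI)
  then show ?thesis
    using assms line_proj_eqI by (auto simp: range_line_proj)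
qed

lemma rank_one_projection_list:
  assumes "set Ps \<subseteq> rank_one_projections"
  obtains xs where "Ps = map line_proj xs" "0 \<notin> set xs"
proof -
  have "\<exists>xs. Ps = map line_proj xs \<and> 0 \<notin> set xs"
    using assms
  proof (induction Ps)
    case (Cons P Ps)
    then obtain xs where xs: "Ps = map line_proj xs" "0 \<notin> set xs"
      by auto
    obtain x where "x \<noteq> 0" "P = line_proj x"
      using Cons.prems rank_one_projection_cases[of P] by auto
    then show ?case
      using xs by (intro exI[of _ "x # xs"]) auto
  qed simp
  then show thesis
    using that by blast
qed

text \<open>
  If the spectra are preserved, let \<open>R\<close> relate \<open>x\<close> to \<open>y\<close> when \<open>\<phi>\<close> sends the projection onto the line of \<open>x\<close> to the one onto the
  line of \<open>y\<close>. Any orthonormal basis can serve as \<open>\<alpha>\<close>.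
\<close>

theorem theorem1p3:
  fixes \<phi> :: "('a::chilbert_space \<Rightarrow> 'a) \<Rightarrow> ('a \<Rightarrow> 'a)"
    and n :: nat
  assumes dim: "cvec.dim (UNIV :: 'a set) = n"
    and n: "3 \<le> n"
    and surj: "\<phi> ` rank_one_projections = rank_one_projections"
  shows "(\<forall>Ps. length Ps = n \<and> set Ps \<subseteq> rank_one_projections \<longrightarrow>
            joint_spectrum (map \<phi> Ps) = joint_spectrum Ps)
     \<longleftrightarrow>
         (\<exists>\<alpha> \<beta> f fhat. is_orthonormal_basis n \<alpha> \<and> is_basis n \<beta> \<and> ring_automorphism f \<and>
            (\<forall>z. fhat (\<Sum>i<n. z i *\<^sub>C \<alpha> i) = (\<Sum>i<n. f (z i) *\<^sub>C \<beta> i)) \<and>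
            (\<forall>P\<in>rank_one_projections. range (\<phi> P) = {fhat (P \<xi>) | \<xi>. True}))"
    (is "?preserves \<longleftrightarrow> ?semilinear")
proof -
  obtain B :: "'a set" where
    fd: "finite_dimensional_list_independence (scaleC :: complex \<Rightarrow> 'a \<Rightarrow> 'a) B" and card_B: "card B = n"
    using finite_dimensional_of_dim[OF dim] n by auto
  note spectrum_iff = joint_spectrum_line_proj_eq_iff[OF fd card_B]
  have \<phi>_line: "\<exists>y. y \<noteq> 0 \<and> \<phi> (line_proj x) = line_proj y" if "x \<noteq> 0" for x
    using surj line_proj_rank_one[OF that] rank_one_projection_cases[of "\<phi> (line_proj x)"] by blast
  show ?thesis
  proof
    assume pres: ?preserves
    define R where "R x y \<longleftrightarrow> x \<noteq> 0 \<and> y \<noteq> 0 \<and> \<phi> (line_proj x) = line_proj y" for x y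
    interpret fd: finite_dimensional_list_independence "scaleC :: complex \<Rightarrow> 'a \<Rightarrow> 'a" B
      by (rule fd)
    interpret corr: line_correspondence "scaleC :: complex \<Rightarrow> 'a \<Rightarrow> 'a" B R
    proof
      show "\<exists>y. R x y" if "x \<noteq> 0" for x
        using \<phi>_line that by (auto simp: R_def)
      show "\<exists>x. R x y" if y: "y \<noteq> 0" for y
      proof -
        obtain P where "P \<in> rank_one_projections" "\<phi> P = line_proj y"
          using surj line_proj_rank_one[OF y] by (metis imageE)
        then show ?thesis
          using rank_one_projection_cases[of P] y by (metis R_def)
      qed
      fix xs ys
      assume R: "list_all2 R xs ys" and len: "length xs = fd.dimension"
      have xs: "length xs = n" "0 \<notin> set xs" and ys: "length ys = n" "0 \<notin> set ys"
        using R len by (auto simp: list_all2_conv_all_nth in_set_conv_nth R_def dimension_eq[OF fd card_B])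
      have "map \<phi> (map line_proj xs) = map line_proj ys"
        using R by (intro nth_equalityI) (auto simp: list_all2_conv_all_nth R_def)
      moreover have "set (map line_proj xs) \<subseteq> rank_one_projections"
        using xs(2) by (auto intro!: line_proj_rank_one)
      ultimately have "joint_spectrum (map line_proj xs) = joint_spectrum (map line_proj ys)"
        using pres xs by (metis length_map)
      then show "cvec_list.lin_indep xs \<longleftrightarrow> cvec_list.lin_indep ys"
        using spectrum_iff xs ys by blast
    qed (auto simp: R_def line_proj_scaleC)
    obtain \<alpha> :: "nat \<Rightarrow> 'a" where \<alpha>: "is_orthonormal_basis n \<alpha>"
      using orthonormal_basis_exists[OF fd card_B] by blast
    note dim_n = dimension_eq[OF fd card_B]
    have "cvec_list.lin_indep (map \<alpha> [0..<fd.dimension])"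
      using \<alpha> is_basis_iff_lin_indep[OF fd card_B] by (simp add: is_orthonormal_basis_def dim_n)
    then obtain f \<beta> where f: "bij f" "\<And>c d. f (c + d) = f c + f d" "\<And>c d. f (c * d) = f c * f d"
      and \<beta>: "cvec_list.lin_indep (map \<beta> [0..<n])"
      and R: "\<And>z. (\<Sum>i<n. z i *\<^sub>C \<alpha> i) \<noteq> 0 \<Longrightarrow> R (\<Sum>i<n. z i *\<^sub>C \<alpha> i) (\<Sum>i<n. f (z i) *\<^sub>C \<beta> i)"
      using corr.fundamental_theorem[of \<alpha>] n unfolding dim_n by blast
    define g where "g v = (\<Sum>i<n. f (cinner (\<alpha> i) v) *\<^sub>C \<beta> i)" for v
    have basis: "is_basis n \<beta>"
      using \<beta> is_basis_iff_lin_indep[OF fd card_B] by blast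
    have aut: "ring_automorphism f"
      using f by (simp add: ring_automorphism_def)
    have g: "\<forall>z. g (\<Sum>i<n. z i *\<^sub>C \<alpha> i) = (\<Sum>i<n. f (z i) *\<^sub>C \<beta> i)"
      by (auto simp: g_def orthonormal_basis_coeff[OF \<alpha>] intro!: sum.cong)
    have "range (\<phi> P) = {g (P \<xi>) | \<xi>. True}" if P: "P \<in> rank_one_projections" for P
    proof -
      obtain x where x: "x \<noteq> 0" "P = line_proj x"
        by (rule rank_one_projection_cases[OF P])
      have "R x (g x)"
        using R[of "\<lambda>i. cinner (\<alpha> i) x"] x(1)
        unfolding orthonormal_basis_expansion[OF \<alpha>, of x, symmetric] g_def by blast
      then show ?thesis
        using semilinear_image_range_line_proj[of g f x] semilinear_extension(2,4)[OF \<alpha> basis aut g]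
        by (simp add: R_def x(2))
    qed
    then show ?semilinear
      using \<alpha> basis aut g by blast
  next
    assume ?semilinear
    then obtain \<alpha> \<beta> f g where \<alpha>: "is_orthonormal_basis n \<alpha>" and \<beta>: "is_basis n \<beta>"
      and f: "ring_automorphism f"
      and g: "\<forall>z. g (\<Sum>i<n. z i *\<^sub>C \<alpha> i) = (\<Sum>i<n. f (z i) *\<^sub>C \<beta> i)"
      and range: "\<And>P. P \<in> rank_one_projections \<Longrightarrow> range (\<phi> P) = {g (P \<xi>) | \<xi>. True}"
      by blast
    note g_semilinear = semilinear_extension[OF \<alpha> \<beta> f g]
    have \<phi>_eq: "\<phi> (line_proj x) = line_proj (g x)" if x: "x \<noteq> 0" for x
    proof -
      obtain y where y: "y \<noteq> 0" "\<phi> (line_proj x) = line_proj y"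
        using \<phi>_line[OF x] by blast
      have "range (line_proj y) = range (line_proj (g x))"
        using range[OF line_proj_rank_one[OF x]] y
          semilinear_image_range_line_proj[of g f x, OF g_semilinear(2,4)] by simp
      then show ?thesis
        using y line_proj_eq_if_range_eq by metis
    qed
    show ?preserves
    proof (intro allI impI)
      fix Ps :: "('a \<Rightarrow> 'a) list"
      assume Ps: "length Ps = n \<and> set Ps \<subseteq> rank_one_projections"
      then obtain xs where xs: "Ps = map line_proj xs" "0 \<notin> set xs"
        using rank_one_projection_list by blast
      have "map \<phi> Ps = map line_proj (map g xs)"
        unfolding xs(1) using xs(2) by (auto intro!: \<phi>_eq)
      moreover have "cvec_list.lin_indep (map g xs) \<longleftrightarrow> cvec_list.lin_indep xs"
        by (rule cvec_list.lin_indep_semilinear_image[of g f]) (rule g_semilinear)+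
      moreover have "0 \<notin> set (map g xs)"
      proof
        assume "0 \<in> set (map g xs)"
        then obtain x where "x \<in> set xs" "g x = 0"
          by (metis imageE list.set_map)
        then show False
          using xs(2) g_semilinear(3)[of x] by blast
      qed
      moreover have "length xs = n"
        using Ps xs(1) by simp
      ultimately have "joint_spectrum (map \<phi> Ps) = joint_spectrum (map line_proj xs)"
        using spectrum_iff[of "map g xs" xs] xs(2) by (metis length_map)
      then show "joint_spectrum (map \<phi> Ps) = joint_spectrum Ps"
        by (simp only: xs(1))
    qed
  qed
qed

end
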